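(* For any $\ell\in\frac12\mathbb{N}$ the $(2\ell+1)\times(2\ell+1)$ weight matrix $W$ on $(-1,1)$ defined in the context satisfies $$\widetilde W(x)=YW(x)Y^t=\begin{pmatrix}W_1(x)&0\\0&W_2(x)\end{pmatrix},$$ with $W_1$ of size $\lceil\ell+\frac12\rceil$ and $W_2$ of size $\lfloor\ell+\frac12\rfloor$. Moreover, if $\{P_{d,1}\}_{d\ge0}$ (resp. $\{P_{d,2}\}_{d\ge0}$) is the sequence of monic matrix orthogonal polynomials with respect to $W_1$ (resp. $W_2$), then $$\widetilde P_d(x)=\begin{pmatrix}P_{d,1}(x)&0\\0&P_{d,2}(x)\end{pmatrix},\quad d\ge0,$$ is a sequence of matrix orthogonal polynomials with respect to $\widetilde W$. There is no further reduction: neither $W_1$ nor $W_2$ reduces to a smaller size.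
   Context: Rows and columns of $W$ are indexed by $\{0,1,\dots,2\ell\}$. $(a)_k=a(a+1)\cdots(a+k-1)$, $(a)_0=1$; $U_k$ is the Chebyshev polynomial of the second kind of degree $k$. The weight matrix is, for $m\le n$, $$W(x)_{n,m}=(1-x^2)^{\frac12}\,\frac{2\ell+1}{n+1}\,\frac{(2\ell-m)!\,m!}{(2\ell)!}\sum_{t=0}^m(-1)^{m-t}\frac{(n-2\ell)_{m-t}}{(n+2)_{m-t}}\frac{(2\ell+2-t)_t}{t!}\,U_{n+m-2t}(x),$$ and $W(x)_{n,m}=W(x)_{m,n}$ if $n<m$. $I_N$ is the identity and $J_N=\sum_{i=0}^{N-1}E_{i,N-1-i}$. The matrix $Y$ is $$Y=\frac1{\sqrt2}\begin{pmatrix}I_{\ell+\frac12}&J_{\ell+\frac12}\\-J_{\ell+\frac12}&I_{\ell+\frac12}\end{pmatrix}\ (\ell\in\tfrac12+\mathbb{N}),\qquad Y=\frac1{\sqrt2}\begin{pmatrix}I_\ell&0&J_\ell\\0&\sqrt2&0\\-J_\ell&0&I_\ell\end{pmatrix}\ (\ell\in\mathbb{N}).$$ (For $\ell=0$ the second block is absent.) A weight matrix on an interval is an integrable matrix-valued function, positive definite almost everywhere, with finite moments. A sequence $\{R_d\}$ of matrix polynomials is orthogonal with respect to a weight $\mathcal W$ on $(-1,1)$ if $R_d$ has degree $d$ with nonsingular leading coefficient and $\int_{-1}^1R_d\mathcal WR_{d'}^*dx=0$ for $d\ne d'$; the monic one is unique. A weight $\mathcal W$ reduces to a smaller size if there is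 a constant nonsingular matrix $M$ such that $\mathcal W(x)=M\begin{pmatrix}\mathcal W_1(x)&0\\0&\mathcal W_2(x)\end{pmatrix}M^*$ for all $x$, with $\mathcal W_1,\mathcal W_2$ weight matrices of smaller (positive) size. *)

theory Defs
  imports "HOL-Analysis.Analysis" "Jordan_Normal_Form.Schur_Decomposition"
begin

text \<open>
  The size of the matrices depends on \<open>\<ell>\<close>, so they are matrices of the type \<open>_ mat\<close> with explicit
  dimensions. The parameter \<open>N\<close> stands for \<open>2\<ell>\<close>. All matrices are complex; for a real matrix the
  adjoint is the transpose.
\<close>

fun chebyshev_U :: "nat \<Rightarrow> real poly" where
  "chebyshev_U 0 = 1"
| "chebyshev_U (Suc 0) = [:0, 2:]"
| "chebyshev_U (Suc (Suc k)) = [:0, 2:] * chebyshev_U (Suc k) - chebyshev_U k"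

text \<open>The entry in row \<open>n\<close> and column \<open>m\<close>, used for \<open>m \<le> n \<le> N\<close> only.\<close>

definition W_lower :: "nat \<Rightarrow> real \<Rightarrow> nat \<Rightarrow> nat \<Rightarrow> real" where
  "W_lower N x n m =
     sqrt (1 - x\<^sup>2) * ((real N + 1) / (real n + 1)) * (fact (N - m) * fact m / fact N) *
     (\<Sum>t = 0..m. (-1) ^ (m - t)
        * (pochhammer (real n - real N) (m - t) / pochhammer (real n + 2) (m - t))
        * (pochhammer (real N + 2 - real t) t / fact t)
        * poly (chebyshev_U (n + m - 2 * t)) x)"

definition W_mat :: "nat \<Rightarrow> real \<Rightarrow> complex mat" where
  "W_mat N x = mat (N + 1) (N + 1)
     (\<lambda>(n, m). complex_of_real (if m \<le> n then W_lower N x n m else W_lower N x m n))"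

definition J_mat :: "nat \<Rightarrow> complex mat" where
  "J_mat k = mat k k (\<lambda>(i, j). if i + j + 1 = k then 1 else 0)"

definition block_diag :: "'a::zero mat \<Rightarrow> 'a mat \<Rightarrow> 'a mat" where
  "block_diag A B = four_block_mat A (0\<^sub>m (dim_row A) (dim_col B)) (0\<^sub>m (dim_row B) (dim_col A)) B"

text \<open>
  For odd \<open>N\<close> the blocks have size \<open>\<ell> + 1/2 = (N + 1) div 2\<close>. For even \<open>N\<close> the \<open>3 \<times> 3\<close> block matrix
  with blocks of sizes \<open>\<ell>\<close>, \<open>1\<close>, \<open>\<ell>\<close>, where \<open>\<ell> = N div 2\<close>, is assembled by first joining the
  first two block rows and block columns.
\<close>

definition Y_mat :: "nat \<Rightarrow> complex mat" where
  "Y_mat N = complex_of_real (1 / sqrt 2) \<cdot>\<^sub>m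
     (if odd N
      then let k = (N + 1) div 2 in
        four_block_mat (1\<^sub>m k) (J_mat k) (- J_mat k) (1\<^sub>m k)
      else let k = N div 2 in
        four_block_mat
          (four_block_mat (1\<^sub>m k) (0\<^sub>m k 1) (0\<^sub>m 1 k) (complex_of_real (sqrt 2) \<cdot>\<^sub>m 1\<^sub>m 1))
          (J_mat k @\<^sub>r 0\<^sub>m 1 k)
          (four_block_mat (- J_mat k) (0\<^sub>m k 1) (0\<^sub>m 0 k) (0\<^sub>m 0 1))
          (1\<^sub>m k))"

definition pos_def_mat :: "nat \<Rightarrow> complex mat \<Rightarrow> bool" where
  "pos_def_mat n A \<longleftrightarrow> A \<in> carrier_mat n n \<and> mat_adjoint A = A \<and>
     (\<forall>v \<in> carrier_vec n. v \<noteq> 0\<^sub>v n \<longrightarrow> Re ((A *\<^sub>v v) \<bullet>c v) > 0)"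

text \<open>Weight matrices of size \<open>n\<close> on \<open>(-1, 1)\<close>; integrability is entrywise, and the moment of order
  \<open>0\<close> gives integrability of the weight itself.\<close>

definition weight_matrix :: "nat \<Rightarrow> (real \<Rightarrow> complex mat) \<Rightarrow> bool" where
  "weight_matrix n \<W> \<longleftrightarrow>
     (\<forall>x \<in> {-1<..<1}. \<W> x \<in> carrier_mat n n) \<and>
     (\<forall>k. \<forall>i<n. \<forall>j<n. integrable (lebesgue_on {-1<..<1}) (\<lambda>x. complex_of_real (x ^ k) * \<W> x $$ (i, j))) \<and>
     (AE x in lebesgue_on {-1<..<1}. pos_def_mat n (\<W> x))"

text \<open>A matrix polynomial is a matrix with polynomial entries.\<close>

definition eval_mat :: "complex poly mat \<Rightarrow> real \<Rightarrow> complex mat" where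
  "eval_mat R x = map_mat (\<lambda>p. poly p (complex_of_real x)) R"

definition coeff_mat :: "complex poly mat \<Rightarrow> nat \<Rightarrow> complex mat" where
  "coeff_mat R k = map_mat (\<lambda>p. coeff p k) R"

text \<open>
  Degree \<open>d\<close> is expressed by the vanishing of all coefficients of higher order together with the
  nonsingularity of the coefficient of order \<open>d\<close>; in size \<open>0\<close>, where the only matrix is the empty one,
  there is no condition. The integrals are entrywise, and their convergence is part of
  the condition. Positivity of \<open>\<W>\<close> plays no role in the condition.
\<close>

definition matrix_OP :: "nat \<Rightarrow> (real \<Rightarrow> complex mat) \<Rightarrow> (nat \<Rightarrow> complex poly mat) \<Rightarrow> bool" where
  "matrix_OP n \<W> R \<longleftrightarrow>
     (\<forall>d. R d \<in> carrier_mat n n \<and>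
          (\<forall>k>d. coeff_mat (R d) k = 0\<^sub>m n n) \<and> invertible_mat (coeff_mat (R d) d)) \<and>
     (\<forall>d d'. d \<noteq> d' \<longrightarrow> (\<forall>i<n. \<forall>j<n.
        has_bochner_integral (lebesgue_on {-1<..<1})
          (\<lambda>x. (eval_mat (R d) x * \<W> x * mat_adjoint (eval_mat (R d') x)) $$ (i, j)) 0))"

definition monic_matrix_OP :: "nat \<Rightarrow> (real \<Rightarrow> complex mat) \<Rightarrow> (nat \<Rightarrow> complex poly mat) \<Rightarrow> bool" where
  "monic_matrix_OP n \<W> R \<longleftrightarrow> matrix_OP n \<W> R \<and> (\<forall>d. coeff_mat (R d) d = 1\<^sub>m n)"

definition reduces :: "nat \<Rightarrow> (real \<Rightarrow> complex mat) \<Rightarrow> bool" where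
  "reduces n \<W> \<longleftrightarrow>
     (\<exists>n1 n2 M \<W>1 \<W>2. 0 < n1 \<and> 0 < n2 \<and> n1 + n2 = n \<and>
        M \<in> carrier_mat n n \<and> invertible_mat M \<and>
        weight_matrix n1 \<W>1 \<and> weight_matrix n2 \<W>2 \<and>
        (\<forall>x \<in> {-1<..<1}. \<W> x = M * block_diag (\<W>1 x) (\<W>2 x) * mat_adjoint M))"

end

theory Submission
  imports Defs
begin

text \<open>
  The weight has the expansion \<open>W(x) = sqrt (1 - x\<^sup>2) (\<Sum>k. C\<^sub>k U\<^sub>k(x))\<close> with constant real matrices \<open>C\<^sub>k\<close>
  whose entries have a closed form (\<open>W_coeff\<close>, \<open>W_mat_expansion\<close>). In this form each \<open>C\<^sub>k\<close> is symmetric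
  and commutes with the reversal \<open>J\<close> of the basis. The rows of \<open>Y\<close> are normalized symmetric and
  antisymmetric vectors, that is, eigenvectors of \<open>J\<close> for the eigenvalues \<open>1\<close> and \<open>-1\<close>. Therefore
  \<open>Y W Y\<^sup>t\<close> has no entries between the two eigenspaces (\<open>Y_W_Y_index\<close>, \<open>folded_eq_0\<close>). All operations in
  the definition of orthogonality respect the block structure, which settles the polynomials
  (\<open>matrix_OP_block_diag\<close>).

  A reduction of a block \<open>\<W>\<close> by a nonsingular \<open>M\<close>, not necessarily unitary, yields a nonscalar
  constant matrix \<open>T\<close> with \<open>T \<W>(x) = \<W>(x) T\<^sup>*\<close> (\<open>reduces_imp_intertwiner\<close>). Since the \<open>U\<^sub>k\<close> are linearly
  independent, \<open>T\<close> satisfies the same relation with every coefficient matrix of the block. Three of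
  them suffice to make \<open>T\<close> scalar (\<open>not_reduces_if_chebyshev_coefficients\<close>). The coefficient of \<open>U\<^sub>0\<close> is
  diagonal. The coefficient of \<open>U\<^sub>N\<close> is antidiagonal in \<open>W\<close>, hence diagonal in each block, and the quotients
  of its diagonal entries by those of the first one are pairwise distinct within a block
  (\<open>folded_ratio\<close>); this makes \<open>T\<close> diagonal. The coefficient of \<open>U\<^sub>1\<close> has nonzero entries next to the
  diagonal (\<open>folded_1_Suc\<close>), and so all diagonal entries of \<open>T\<close> coincide.
\<close>

section \<open>The weight in the basis of Chebyshev polynomials\<close>

lemma fact_mult_pochhammer_Suc:
  "fact a * pochhammer (real a + 1) k = (fact (a + k) :: real)"
proof (induction k)
  case (Suc k)
  have "fact a * pochhammer (real a + 1) (Suc k) = fact (a + k) * (real a + 1 + real k)"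
    unfolding pochhammer_Suc Suc[symmetric] by simp
  then show ?case
    by (simp add: mult.commute add_ac)
qed simp

text \<open>
  The division-free form avoids case distinctions on quotients of factorials later on.
\<close>

lemma fact_mult_pochhammer_falling:
  assumes "k \<le> a"
  shows "fact (a - k) * ((-1) ^ k * pochhammer (- real a) k) = fact a"
proof -
  have "(-1) ^ k * pochhammer (- real a) k = pochhammer (real (a - k) + 1) k"
    using assms by (simp add: pochhammer_minus of_nat_diff)
  then show ?thesis
    using assms fact_mult_pochhammer_Suc[of "a - k" k] by simp
qed

text \<open>
  The coefficient of \<open>U\<^sub>k\<close> in the entry \<open>(n, m)\<close> of \<open>W\<close>, with \<open>t = (n + m - k) / 2\<close> the summation index of
  the defining formula and \<open>s = (2 N - n - m - k) / 2\<close> its image under reversal. The support is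
  given by the triangle conditions on \<open>(n, m, k)\<close> that occur for Clebsch--Gordan coefficients. This form
  is visibly symmetric under \<open>n \<leftrightarrow> m\<close>, and reversal \<open>(n, m) \<mapsto> (N - n, N - m)\<close> only exchanges \<open>t\<close> and
  \<open>s\<close>; neither symmetry can be read off from the defining sum.
\<close>

definition W_coeff :: "nat \<Rightarrow> nat \<Rightarrow> nat \<Rightarrow> nat \<Rightarrow> real" where
  "W_coeff N k n m =
     (if n \<le> m + k \<and> m \<le> n + k \<and> k \<le> n + m \<and> k + n + m \<le> 2 * N \<and> even (k + n + m)
      then (real N + 1)\<^sup>2 * (fact n * fact m * fact (N - n) * fact (N - m)) /
        (fact ((n + m - k) div 2) * fact (N + 1 - (n + m - k) div 2) *
         (fact ((2 * N - n - m - k) div 2) * fact (N + 1 - (2 * N - n - m - k) div 2)))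
      else 0)"

lemma W_coeff_commute: "W_coeff N k n m = W_coeff N k m n"
proof -
  have "2 * N - n - m - k = 2 * N - m - n - k"
    by simp
  then show ?thesis
    unfolding W_coeff_def by (simp only: conj_ac mult_ac add_ac)
qed

lemma W_coeff_nonneg: "W_coeff N k n m \<ge> 0"
  by (simp add: W_coeff_def)

lemma W_coeff_reverse:
  assumes "n \<le> N" "m \<le> N"
  shows "W_coeff N k (N - n) (N - m) = W_coeff N k n m"
proof -
  have "N - n \<le> N - m + k \<longleftrightarrow> m \<le> n + k" "N - m \<le> N - n + k \<longleftrightarrow> n \<le> m + k"
    "k \<le> N - n + (N - m) \<longleftrightarrow> k + n + m \<le> 2 * N" "k + (N - n) + (N - m) \<le> 2 * N \<longleftrightarrow> k \<le> n + m"
    "even (k + (N - n) + (N - m)) \<longleftrightarrow> even (k + n + m)"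
    "N - n + (N - m) - k = 2 * N - n - m - k"
    "N - (N - n) = n" "N - (N - m) = m"
    using assms by (auto simp: even_diff_nat)
  moreover have "2 * N - (N - n) - (N - m) - k = n + m - k"
    using assms by auto
  ultimately show ?thesis
    unfolding W_coeff_def by (simp only: conj_ac mult_ac)
qed

text \<open>
  Writing \<open>s = N + t - n - m\<close>, up to sign the Pochhammer symbols are the quotients
  \<open>(N - n)! / s!\<close>, \<open>(N + 1 - s)! / (n + 1)!\<close> and \<open>(N + 1)! / (N + 1 - t)!\<close>. When \<open>s\<close> would be negative, the first symbol
  contains the factor \<open>0\<close>, and the triangle condition \<open>k + n + m \<le> 2 N\<close> fails.
\<close>

lemma W_lower_summand:
  assumes "m \<le> n" "n \<le> N" "t \<le> m"
  shows "(real N + 1) / (real n + 1) * (fact (N - m) * fact m / fact N) *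
     ((-1) ^ (m - t) * (pochhammer (real n - real N) (m - t) / pochhammer (real n + 2) (m - t))
        * (pochhammer (real N + 2 - real t) t / fact t)) = W_coeff N (n + m - 2 * t) n m"
proof (cases "m - t \<le> N - n")
  case False
  then have "pochhammer (real n - real N) (m - t) = 0"
    using assms pochhammer_of_nat_eq_0_lemma[of "N - n" "m - t", where 'a = real]
    by (simp add: of_nat_diff)
  moreover have "\<not> n + m - 2 * t + n + m \<le> 2 * N"
    using False assms by auto
  ultimately show ?thesis
    by (simp add: W_coeff_def)
next
  case True
  define s where "s = N + t - n - m"
  define a b c where "a = (-1) ^ (m - t) * pochhammer (real n - real N) (m - t)"
    and "b = pochhammer (real n + 2) (m - t)" and "c = pochhammer (real N + 2 - real t) t"
  have s: "N - n - (m - t) = s" "N + 1 - s = Suc n + (m - t)"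
    using True assms by (auto simp: s_def)
  have a: "fact s * a = fact (N - n)"
    using fact_mult_pochhammer_falling[OF True] assms s by (simp add: a_def of_nat_diff)
  have b: "fact (Suc n) * b = fact (N + 1 - s)"
    using fact_mult_pochhammer_Suc[of "Suc n" "m - t"] s unfolding b_def by (simp add: add.commute)
  have c: "fact (N + 1 - t) * c = fact (Suc N)"
    using fact_mult_pochhammer_Suc[of "N + 1 - t" t] assms
    by (simp add: c_def of_nat_diff add.commute algebra_simps)
  have C: "W_coeff N (n + m - 2 * t) n m =
    (real N + 1)\<^sup>2 * (fact n * fact m * fact (N - n) * fact (N - m)) /
      (fact t * fact (N + 1 - t) * (fact s * fact (N + 1 - s)))"
  proof -
    have "n + m - (n + m - 2 * t) = 2 * t" "2 * N - n - m - (n + m - 2 * t) = 2 * s"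
      "even (n + m - 2 * t + n + m)"
      using assms True by (auto simp: s_def)
    then show ?thesis
      using assms True by (auto simp: W_coeff_def)
  qed
  have "a = fact (N - n) / fact s" "b = fact (N + 1 - s) / fact (Suc n)"
    "c = fact (Suc N) / fact (N + 1 - t)"
    using a b c by (simp_all add: field_simps del: fact_Suc)
  then have "a / b * (c / fact t) = fact (N - n) / fact s / (fact (N + 1 - s) / fact (Suc n)) *
      (fact (Suc N) / fact (N + 1 - t) / fact t)"
    by (simp only:)
  moreover have "(real N + 1) / (real n + 1) * (fact (N - m) * fact m / fact N) * \<dots>
     = W_coeff N (n + m - 2 * t) n m"
    unfolding C fact_Suc[of n] fact_Suc[of N]
    by (simp add: divide_simps power2_eq_square add.commute)
  ultimately have "(real N + 1) / (real n + 1) * (fact (N - m) * fact m / fact N) * (a / b * (c / fact t))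
     = W_coeff N (n + m - 2 * t) n m"
    by simp
  then show ?thesis
    by (simp add: a_def b_def c_def)
qed

text \<open>
  The indices \<open>k = n + m - 2 t\<close> of the defining sum are exactly those of parity \<open>n + m\<close> between \<open>n - m\<close>
  and \<open>n + m\<close>. Since the coefficients vanish elsewhere, the sum may be taken over a range that does
  not depend on the entry; this makes coefficients of different entries comparable.
\<close>

lemma W_lower_expansion:
  assumes "m \<le> n" "n \<le> N"
  shows "W_lower N x n m =
    sqrt (1 - x\<^sup>2) * (\<Sum>k\<le>2 * N. W_coeff N k n m * poly (chebyshev_U k) x)"
proof -
  let ?g = "\<lambda>t. n + m - 2 * t"
  have "W_lower N x n m = sqrt (1 - x\<^sup>2) *
    (\<Sum>t = 0..m. W_coeff N (?g t) n m * poly (chebyshev_U (?g t)) x)"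
    unfolding W_lower_def mult.assoc sum_distrib_left
    using assms
    by (intro sum.cong refl arg_cong[where f = "(*) _"])
       (simp add: W_lower_summand[symmetric] mult.assoc)
  also have "(\<Sum>t = 0..m. W_coeff N (?g t) n m * poly (chebyshev_U (?g t)) x) =
    (\<Sum>k\<in>?g ` {0..m}. W_coeff N k n m * poly (chebyshev_U k) x)"
    using assms by (subst sum.reindex) (auto simp: inj_on_def)
  also have "\<dots> = (\<Sum>k\<le>2 * N. W_coeff N k n m * poly (chebyshev_U k) x)"
  proof (rule sum.mono_neutral_left)
    show "\<forall>k\<in>{..2 * N} - ?g ` {0..m}. W_coeff N k n m * poly (chebyshev_U k) x = 0"
    proof
      fix k assume k: "k \<in> {..2 * N} - ?g ` {0..m}"
      have "W_coeff N k n m = 0"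
      proof (rule ccontr)
        assume "W_coeff N k n m \<noteq> 0"
        then have "n \<le> m + k" "k \<le> n + m" "even (k + n + m)"
          by (auto simp: W_coeff_def split: if_splits)
        then obtain e where "k + n + m = 2 * e"
          by (elim evenE)
        with \<open>n \<le> m + k\<close> \<open>k \<le> n + m\<close> assms have "k = ?g (e - k)" "e - k \<in> {0..m}"
          by auto
        then show False
          using k by blast
      qed
      then show "W_coeff N k n m * poly (chebyshev_U k) x = 0"
        by simp
    qed
  qed (use assms in auto)
  finally show ?thesis .
qed

lemma W_mat_expansion:
  assumes "n \<le> N" "m \<le> N"
  shows "W_mat N x $$ (n, m) = complex_of_real
    (sqrt (1 - x\<^sup>2) * (\<Sum>k\<le>2 * N. W_coeff N k n m * poly (chebyshev_U k) x))"
  using assms W_lower_expansion[of m n N x] W_lower_expansion[of n m N x]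
  by (auto simp: W_mat_def W_coeff_commute[of N _ m n])

lemma W_mat_reverse:
  assumes "i \<le> N" "j \<le> N"
  shows "W_mat N x $$ (N - i, N - j) = W_mat N x $$ (i, j)"
  using assms by (simp add: W_mat_expansion W_coeff_reverse)

lemma W_mat_carrier: "W_mat N x \<in> carrier_mat (N + 1) (N + 1)"
  by (simp add: W_mat_def)

section \<open>Folding the weight by its reversal symmetry\<close>

text \<open>
  Row \<open>i\<close> of \<open>Y\<close> is \<open>c\<^sub>i (e\<^sub>i + \<sigma>\<^sub>i e\<^bsub>N - i\<^esub>)\<close> with \<open>c\<^sub>i = Y_scale N i\<close> and \<open>\<sigma>\<^sub>i = Y_sign N i\<close>: the rows are
  eigenvectors of the reversal \<open>J\<close>, with eigenvalue \<open>1\<close> in the first block and \<open>-1\<close> in the second.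
  For even \<open>N\<close> the middle row is \<open>e\<^bsub>N / 2\<^esub>\<close>, counted twice with weight \<open>1 / 2\<close>, so that both parities
  of \<open>N\<close> are covered by one formula.
\<close>

definition Y_scale :: "nat \<Rightarrow> nat \<Rightarrow> real" where
  "Y_scale N i = (if 2 * i = N then 1 / 2 else 1 / sqrt 2)"

definition Y_sign :: "nat \<Rightarrow> nat \<Rightarrow> real" where
  "Y_sign N i = (if 2 * i \<le> N then 1 else -1)"

lemma Y_mat_carrier: "Y_mat N \<in> carrier_mat (N + 1) (N + 1)"
proof (cases "odd N")
  case True
  then have "(N + 1) div 2 + (N + 1) div 2 = N + 1" by presburger
  with True show ?thesis unfolding Y_mat_def Let_def
    by (intro carrier_matI) (simp_all only: if_True not_False_eq_True index_smult_mat index_mat_four_block index_one_mat)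
next
  case False
  then have "N div 2 + N div 2 = N" by auto
  with False show ?thesis unfolding Y_mat_def Let_def
    by (intro carrier_matI) (simp_all add: append_rows_def J_mat_def)
qed

lemma Y_mat_index:
  assumes "i \<le> N" "a \<le> N"
  shows "Y_mat N $$ (i, a) =
    complex_of_real (Y_scale N i * (of_bool (a = i) + Y_sign N i * of_bool (a = N - i)))"
proof (cases "odd N")
  case True
  then obtain k where k: "N = 2 * k + 1"
    by (elim oddE)
  have "2 * i \<noteq> N" "2 * i \<le> N \<longleftrightarrow> i < k + 1"
    using k by presburger+
  then show ?thesis
    using assms k
    by (auto simp: Y_mat_def J_mat_def Y_scale_def Y_sign_def of_bool_def)
next
  case False
  then obtain k where k: "N = 2 * k"
    by auto
  let ?c = "complex_of_real (1 / sqrt 2)"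
  have c: "?c * complex_of_real (sqrt 2) = 1"
    by (simp only: of_real_mult[symmetric]) simp
  have Y: "Y_mat N $$ (i, a) = ?c *
    (if i < k + 1 then if a < k + 1 then
        (if i < k then if a < k then of_bool (i = a) else 0
         else if a < k then 0 else complex_of_real (sqrt 2))
      else if i < k then of_bool (i + (a - (k + 1)) + 1 = k) else 0
     else if a < k + 1 then if a < k then - of_bool (i - (k + 1) + a + 1 = k) else 0
      else of_bool (i - (k + 1) = a - (k + 1)))"
    using assms k by (simp add: Y_mat_def J_mat_def append_rows_def)
  consider "i < k" | "i = k" | "k < i"
    by linarith
  then show ?thesis
  proof cases
    case 1
    then have "Y_scale N i = 1 / sqrt 2" "Y_sign N i = 1"
      using k by (auto simp: Y_scale_def Y_sign_def)
    then show ?thesis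
      unfolding Y using 1 assms k by (auto simp: of_bool_def)
  next
    case 2
    then have *: "Y_scale N i = 1 / 2" "Y_sign N i = 1" "N - i = i"
      using k by (auto simp: Y_scale_def Y_sign_def)
    then show ?thesis
      unfolding Y * using 2 assms c by (auto simp: of_bool_def simp del: of_real_divide)
  next
    case 3
    then have "Y_scale N i = 1 / sqrt 2" "Y_sign N i = -1"
      using k by (auto simp: Y_scale_def Y_sign_def)
    then show ?thesis
      unfolding Y using 3 assms k by (auto simp: of_bool_def)
  qed
qed

lemma sum_Y_mat_row:
  assumes "i \<le> N"
  shows "(\<Sum>a\<le>N. Y_mat N $$ (i, a) * g a) =
    complex_of_real (Y_scale N i) * (g i + complex_of_real (Y_sign N i) * g (N - i))"
proof -
  have "(\<Sum>a\<le>N. Y_mat N $$ (i, a) * g a) = (\<Sum>a\<le>N. complex_of_real (Y_scale N i) *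
      ((if a = i then g i else 0) + complex_of_real (Y_sign N i) * (if a = N - i then g (N - i) else 0)))"
    using assms by (intro sum.cong refl) (auto simp: Y_mat_index algebra_simps)
  also have "\<dots> = complex_of_real (Y_scale N i) * (g i + complex_of_real (Y_sign N i) * g (N - i))"
    using assms by (simp add: sum.distrib flip: sum_distrib_left)
  finally show ?thesis .
qed

text \<open>
  The coefficient of \<open>U\<^sub>k\<close> in the entry \<open>(i, j)\<close> of \<open>Y W Y\<^sup>t\<close>. Reversal symmetry merges the four terms
  of \<open>y\<^sub>i W y\<^sub>j\<^sup>t\<close> into two; the factor \<open>1 + \<sigma>\<^sub>i \<sigma>\<^sub>j\<close> kills the entries that join rows of opposite sign.
\<close>

definition folded_coeff :: "nat \<Rightarrow> nat \<Rightarrow> nat \<Rightarrow> nat \<Rightarrow> real" where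
  "folded_coeff N k i j = Y_scale N i * Y_scale N j * (1 + Y_sign N i * Y_sign N j) *
     (W_coeff N k i j + Y_sign N j * W_coeff N k i (N - j))"

lemma index_mult_mat_sum:
  fixes A B :: "'a::semiring_0 mat"
  assumes "A \<in> carrier_mat n m" "B \<in> carrier_mat m k" "i < n" "j < k"
  shows "(A * B) $$ (i, j) = (\<Sum>a<m. A $$ (i, a) * B $$ (a, j))"
  using assms by (simp add: scalar_prod_def atLeast0LessThan)

lemma Y_W_Y_index:
  assumes "i \<le> N" "j \<le> N"
  shows "(Y_mat N * W_mat N x * transpose_mat (Y_mat N)) $$ (i, j) = complex_of_real
    (sqrt (1 - x\<^sup>2) * (\<Sum>k\<le>2 * N. folded_coeff N k i j * poly (chebyshev_U k) x))"
proof -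
  let ?c = "\<lambda>i. complex_of_real (Y_scale N i)" and ?s = "\<lambda>i. complex_of_real (Y_sign N i)"
  let ?W = "\<lambda>a b. W_mat N x $$ (a, b)"
  note carr = Y_mat_carrier[of N] W_mat_carrier[of N x]
  have YW: "(Y_mat N * W_mat N x) $$ (i, b) = ?c i * (?W i b + ?s i * ?W (N - i) b)" if "b \<le> N" for b
  proof -
    have "(Y_mat N * W_mat N x) $$ (i, b) = (\<Sum>a\<le>N. Y_mat N $$ (i, a) * ?W a b)"
      using index_mult_mat_sum[OF carr, of i b] assms that by (simp add: lessThan_Suc_atMost)
    then show ?thesis
      using sum_Y_mat_row[OF assms(1)] by simp
  qed
  have "(Y_mat N * W_mat N x * transpose_mat (Y_mat N)) $$ (i, j) =
      (\<Sum>b\<le>N. Y_mat N $$ (j, b) * (Y_mat N * W_mat N x) $$ (i, b))"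
    using index_mult_mat_sum[of "Y_mat N * W_mat N x" "N + 1" "N + 1" "transpose_mat (Y_mat N)" "N + 1" i j]
      assms carr by (simp add: lessThan_Suc_atMost mult.commute del: assoc_mult_mat index_mult_mat(1))
  also have "\<dots> = ?c j * (?c i * (?W i j + ?s i * ?W (N - i) j) +
      ?s j * (?c i * (?W i (N - j) + ?s i * ?W (N - i) (N - j))))"
    using assms by (simp add: sum_Y_mat_row YW)
  also have "\<dots> = ?c i * ?c j * ((?W i j + ?s i * ?s j * ?W (N - i) (N - j)) +
      (?s j * ?W i (N - j) + ?s i * ?W (N - i) j))"
    by (simp add: algebra_simps)
  also have "?W (N - i) (N - j) = ?W i j"
    using assms by (rule W_mat_reverse)
  also have "?W (N - i) j = ?W i (N - j)"
    using W_mat_reverse[of i N "N - j" x] assms by simp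
  also have "?c i * ?c j * ((?W i j + ?s i * ?s j * ?W i j) + (?s j * ?W i (N - j) + ?s i * ?W i (N - j)))
      = ?c i * ?c j * (1 + ?s i * ?s j) * (?W i j + ?s j * ?W i (N - j))"
    by (auto simp: Y_sign_def algebra_simps)
  also have "\<dots> = complex_of_real (sqrt (1 - x\<^sup>2) * (\<Sum>k\<le>2 * N. folded_coeff N k i j * poly (chebyshev_U k) x))"
  proof -
    let ?S = "\<lambda>j. sqrt (1 - x\<^sup>2) * (\<Sum>k\<le>2 * N. W_coeff N k i j * poly (chebyshev_U k) x)"
    define K where "K = Y_scale N i * Y_scale N j * (1 + Y_sign N i * Y_sign N j)"
    have "folded_coeff N k i j = K * (W_coeff N k i j + Y_sign N j * W_coeff N k i (N - j))" for k
      by (simp only: folded_coeff_def K_def)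
    then have "folded_coeff N k i j * poly (chebyshev_U k) x = K * (W_coeff N k i j * poly (chebyshev_U k) x) +
        K * Y_sign N j * (W_coeff N k i (N - j) * poly (chebyshev_U k) x)" for k
      by (simp add: algebra_simps)
    then have "sqrt (1 - x\<^sup>2) * (\<Sum>k\<le>2 * N. folded_coeff N k i j * poly (chebyshev_U k) x) =
        K * (?S j + Y_sign N j * ?S (N - j))"
      by (simp only: sum.distrib sum_distrib_left[symmetric]) (simp only: algebra_simps)
    then show ?thesis
      using assms by (simp add: W_mat_expansion K_def)
  qed
  finally show ?thesis .
qed

lemma folded_eq_0:
  assumes "Y_sign N i \<noteq> Y_sign N j"
  shows "folded_coeff N k i j = 0"
  using assms by (auto simp: folded_coeff_def Y_sign_def split: if_splits)

section \<open>Three coefficient matrices of the folded_coeff weight\<close>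

text \<open>
  The coefficient of \<open>U\<^sub>0\<close> in \<open>W\<close> is a diagonal matrix and that of \<open>U\<^sub>N\<close> an antidiagonal one. On
  eigenvectors of the reversal an antidiagonal matrix acts as a diagonal one.
\<close>

lemma folded_diagonal:
  assumes "i \<le> N" "j \<le> N" "i \<noteq> j"
  shows "folded_coeff N 0 i j = 0 \<and> folded_coeff N N i j = 0"
proof (cases "Y_sign N i = Y_sign N j")
  case True
  then have "i + j \<noteq> N"
    using assms by (auto simp: Y_sign_def split: if_splits)
  then have "W_coeff N 0 i j = 0" "W_coeff N 0 i (N - j) = 0" "W_coeff N N i j = 0"
    "W_coeff N N i (N - j) = 0"
    using assms by (auto simp: W_coeff_def)
  then show ?thesis
    by (simp add: folded_coeff_def)
qed (simp add: folded_eq_0)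

text \<open>
  On the diagonal the prefactor \<open>2 c\<^sub>i\<^sup>2\<close> is \<open>1\<close>, except in the middle row of even \<open>N\<close>, where it is
  \<open>1 / 2\<close> but the two terms of the folded_coeff coefficient coincide.
\<close>

lemma folded_0_diag:
  assumes "i \<le> N"
  shows "folded_coeff N 0 i i = (real N + 1)\<^sup>2 / ((real i + 1) * (real (N - i) + 1))"
proof -
  have "W_coeff N 0 i i = (real N + 1)\<^sup>2 / ((real i + 1) * (real (N - i) + 1))"
  proof -
    have "(2 * N - i - i) div 2 = N - i" "N + 1 - (N - i) = Suc i" "N + 1 - i = Suc (N - i)"
      using assms by auto
    then show ?thesis
      using assms by (simp add: W_coeff_def divide_simps) (simp add: algebra_simps)
  qed
  moreover have "folded_coeff N 0 i i = W_coeff N 0 i i"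
  proof (cases "2 * i = N")
    case True
    then show ?thesis
      by (auto simp: folded_coeff_def Y_scale_def Y_sign_def)
  next
    case False
    then have "W_coeff N 0 i (N - i) = 0"
      using assms by (auto simp: W_coeff_def)
    then show ?thesis
      using False by (auto simp: folded_coeff_def Y_scale_def Y_sign_def field_simps)
  qed
  ultimately show ?thesis
    by simp
qed

lemma folded_N_diag:
  assumes "i \<le> N"
  shows "folded_coeff N N i i = Y_sign N i * (fact i * fact (N - i) / fact N)\<^sup>2"
proof -
  have "W_coeff N N i (N - i) = (fact i * fact (N - i) / fact N)\<^sup>2"
    using assms by (simp add: W_coeff_def divide_simps power2_eq_square mult_ac) (auto simp: algebra_simps)
  moreover have "folded_coeff N N i i = Y_sign N i * W_coeff N N i (N - i)"
  proof (cases "2 * i = N")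
    case True
    then show ?thesis
      by (auto simp: folded_coeff_def Y_scale_def Y_sign_def)
  next
    case False
    then have "W_coeff N N i i = 0"
      using assms by (auto simp: W_coeff_def)
    then show ?thesis
      using False by (auto simp: folded_coeff_def Y_scale_def Y_sign_def field_simps)
  qed
  ultimately show ?thesis
    by simp
qed

text \<open>
  Up to sign and a factor that depends on \<open>N\<close> only, this is the quotient of the diagonal entries of the
  coefficients of \<open>U\<^sub>N\<close> and \<open>U\<^sub>0\<close>. It is a multiple of \<open>(i + 1) (N - i + 1) / (N choose i)\<^sup>2\<close>.
\<close>

definition ratio_weight :: "nat \<Rightarrow> nat \<Rightarrow> real" where
  "ratio_weight N i = (real i + 1) * (real (N - i) + 1) * (fact i * fact (N - i))\<^sup>2"

text \<open>
  Passing from \<open>b\<close> to \<open>b + 1\<close> multiplies the weight by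
  \<open>(b + 1) (b + 2) / ((N - b) (N - b + 1))\<close>, which is less than \<open>1\<close> as long as \<open>b + 1\<close> is at most
  \<open>N / 2\<close>.
\<close>

lemma ratio_weight_less:
  assumes "i < j" "2 * j \<le> N"
  shows "ratio_weight N j < ratio_weight N i"
  using assms
proof (induction j rule: less_induct)
  case (less j)
  then obtain b where b: "j = Suc b"
    by (cases j) auto
  define c where "c = N - Suc b"
  have c: "N - b = Suc c" "Suc b \<le> c"
    using less.prems b by (auto simp: c_def)
  have "ratio_weight N j = (fact b * fact c)\<^sup>2 * ((real b + 2) * (real c + 1) * (real b + 1)\<^sup>2)"
    by (simp add: ratio_weight_def b c_def[symmetric] power_mult_distrib power2_eq_square add_ac)
  also have "\<dots> < (fact b * fact c)\<^sup>2 * ((real b + 1) * (real c + 2) * (real c + 1)\<^sup>2)"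
  proof (rule mult_strict_left_mono)
    have "(real b + 2) * (real b + 1) < (real c + 2) * (real c + 1)"
      using c by (intro mult_strict_mono) auto
    then have "(real b + 2) * (real b + 1) * ((real b + 1) * (real c + 1)) <
        (real c + 2) * (real c + 1) * ((real b + 1) * (real c + 1))"
      by (intro mult_strict_right_mono) auto
    then show "(real b + 2) * (real c + 1) * (real b + 1)\<^sup>2 < (real b + 1) * (real c + 2) * (real c + 1)\<^sup>2"
      by (simp add: power2_eq_square mult_ac)
  qed simp
  also have "\<dots> = ratio_weight N b"
    by (simp add: ratio_weight_def c power_mult_distrib power2_eq_square add_ac)
  finally have "ratio_weight N j < ratio_weight N b" .
  then show ?case
    using less.IH[of b] less.prems b by (cases "b = i") auto
qed

lemma ratio_weight_reverse: "i \<le> N \<Longrightarrow> ratio_weight N (N - i) = ratio_weight N i"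
  by (simp add: ratio_weight_def mult_ac)

text \<open>
  \<open>ratio_weight N\<close> is injective on either half of \<open>{0..N}\<close>, decreasing on the first and, by
  reversal, increasing on the second. The two halves are the two blocks, so only rows of equal sign are compared.
\<close>

lemma folded_ratio:
  assumes "i < j" "j \<le> N" "Y_sign N i = Y_sign N j"
  shows "folded_coeff N 0 i i * folded_coeff N N j j \<noteq> folded_coeff N 0 j j * folded_coeff N N i i"
proof
  assume *: "folded_coeff N 0 i i * folded_coeff N N j j = folded_coeff N 0 j j * folded_coeff N N i i"
  let ?d = "\<lambda>i. (real i + 1) * (real (N - i) + 1)" and ?e = "\<lambda>i. (fact i * fact (N - i))\<^sup>2 :: real"
  have s: "Y_sign N j \<noteq> 0"
    by (simp add: Y_sign_def)
  have "(real N + 1)\<^sup>2 / ?d i * (Y_sign N j * (?e j / (fact N)\<^sup>2)) =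
      (real N + 1)\<^sup>2 / ?d j * (Y_sign N j * (?e i / (fact N)\<^sup>2))"
    using * assms by (simp only: folded_0_diag folded_N_diag power_divide less_imp_le le_less_trans)
  then have "Y_sign N j * ((real N + 1)\<^sup>2 / ?d i * (?e j / (fact N)\<^sup>2)) =
      Y_sign N j * ((real N + 1)\<^sup>2 / ?d j * (?e i / (fact N)\<^sup>2))"
    by (simp only: mult.left_commute)
  then have "(real N + 1)\<^sup>2 / ?d i * (?e j / (fact N)\<^sup>2) = (real N + 1)\<^sup>2 / ?d j * (?e i / (fact N)\<^sup>2)"
    by (rule mult_left_cancel[OF s, THEN iffD1])
  moreover have "r * q = p * t" if "a / p * (q / f) = a / r * (t / f)" "a \<noteq> 0" "p \<noteq> 0" "r \<noteq> 0" "f \<noteq> 0"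
    for a p q r t f :: real
    using that by (simp add: field_simps)
  moreover have "?d i \<noteq> 0" "?d j \<noteq> 0" "(fact N)\<^sup>2 \<noteq> (0 :: real)"
    by simp_all
  moreover have "(real N + 1)\<^sup>2 \<noteq> 0"
    by simp
  ultimately have "?d j * ?e j = ?d i * ?e i"
    by blast
  then have eq: "ratio_weight N j = ratio_weight N i"
    by (simp add: ratio_weight_def)
  show False
  proof (cases "2 * j \<le> N")
    case True
    then show False
      using ratio_weight_less[of i j N] assms(1) eq by simp
  next
    case False
    then have "\<not> 2 * i \<le> N"
      using assms(3) by (auto simp: Y_sign_def split: if_splits)
    then have "ratio_weight N (N - i) < ratio_weight N (N - j)"
      using assms by (intro ratio_weight_less) auto
    then show False
      using eq assms by (simp add: ratio_weight_reverse)
  qed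
qed

text \<open>
  In the first block both terms are nonnegative. In the second block the term with the minus sign would
  require \<open>|N - 2 i - 1| \<le> 1\<close>, which means that row \<open>i\<close> lies in the first half.
\<close>

lemma folded_1_Suc:
  assumes "Suc i \<le> N" "Y_sign N i = Y_sign N (Suc i)"
  shows "folded_coeff N 1 i (Suc i) \<noteq> 0"
proof -
  have pos: "W_coeff N 1 i (Suc i) > 0"
    using assms(1) by (simp add: W_coeff_def)
  have "Y_sign N (Suc i) * W_coeff N 1 i (N - Suc i) \<ge> 0"
  proof (cases "2 * Suc i \<le> N")
    case True
    then show ?thesis
      by (simp add: Y_sign_def W_coeff_nonneg)
  next
    case False
    then have "\<not> 2 * i \<le> N"
      using assms(2) by (auto simp: Y_sign_def split: if_splits)
    then have "W_coeff N 1 i (N - Suc i) = 0"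
      using assms(1) by (auto simp: W_coeff_def)
    then show ?thesis
      by simp
  qed
  with pos have "W_coeff N 1 i (Suc i) + Y_sign N (Suc i) * W_coeff N 1 i (N - Suc i) \<noteq> 0"
    by linarith
  then show ?thesis
    using assms(2) by (auto simp: folded_coeff_def Y_scale_def Y_sign_def)
qed

section \<open>Adjoints and block diagonal matrices\<close>

lemma mat_adjoint_index:
  fixes A :: "complex mat"
  assumes "i < dim_col A" "j < dim_row A"
  shows "mat_adjoint A $$ (i, j) = cnj (A $$ (j, i))"
  using assms unfolding mat_adjoint_def by (simp add: mat_of_rows_index)

lemma mat_adjoint_dim:
  "dim_row (mat_adjoint A) = dim_col A" "dim_col (mat_adjoint A) = dim_row A"
  by (auto simp: mat_adjoint_def)

lemma mat_adjoint_carrier: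
  "A \<in> carrier_mat n m \<Longrightarrow> mat_adjoint A \<in> carrier_mat m n"
  by (auto simp: mat_adjoint_dim)

lemma mat_adjoint_mult:
  fixes A B :: "complex mat"
  assumes "A \<in> carrier_mat n m" "B \<in> carrier_mat m k"
  shows "mat_adjoint (A * B) = mat_adjoint B * mat_adjoint A"
  using assms
  by (intro eq_matI) (auto simp: mat_adjoint_index mat_adjoint_dim scalar_prod_def mult.commute)

lemma mat_adjoint_one: "mat_adjoint (1\<^sub>m n :: complex mat) = 1\<^sub>m n"
  by (intro eq_matI) (auto simp: mat_adjoint_index mat_adjoint_dim)

lemma block_diag_carrier:
  "A \<in> carrier_mat n n \<Longrightarrow> B \<in> carrier_mat m m \<Longrightarrow> block_diag A B \<in> carrier_mat (n + m) (n + m)"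
  unfolding block_diag_def by auto

lemma block_diag_index:
  assumes "A \<in> carrier_mat n n" "B \<in> carrier_mat m m" "i < n + m" "j < n + m"
  shows "block_diag A B $$ (i, j) = (if i < n then if j < n then A $$ (i, j) else 0
    else if j < n then 0 else B $$ (i - n, j - n))"
  using assms by (auto simp: block_diag_def)

lemma block_diag_mult:
  fixes A B C D :: "'a::semiring_0 mat"
  assumes "A \<in> carrier_mat n n" "B \<in> carrier_mat m m" "C \<in> carrier_mat n n" "D \<in> carrier_mat m m"
  shows "block_diag A B * block_diag C D = block_diag (A * C) (B * D)"
  using assms unfolding block_diag_def
  by (subst mult_four_block_mat[where ?nr1.0 = n and ?n1.0 = n and ?n2.0 = m and ?nr2.0 = m]) auto

lemma mat_adjoint_block_diag:
  fixes A B :: "complex mat"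
  assumes "A \<in> carrier_mat n n" "B \<in> carrier_mat m m"
  shows "mat_adjoint (block_diag A B) = block_diag (mat_adjoint A) (mat_adjoint B)"
  using assms
  by (intro eq_matI) (auto simp: block_diag_def mat_adjoint_index mat_adjoint_dim)

lemma invertible_block_diag:
  fixes A B :: "complex mat"
  assumes "A \<in> carrier_mat n n" "B \<in> carrier_mat m m" "invertible_mat A" "invertible_mat B"
  shows "invertible_mat (block_diag A B)"
proof -
  have inv: "\<exists>C \<in> carrier_mat n n. A * C = 1\<^sub>m n \<and> C * A = 1\<^sub>m n"
    if A: "A \<in> carrier_mat n n" "invertible_mat A" for A :: "complex mat" and n
  proof -
    obtain C where "inverts_mat A C" "inverts_mat C A"
      using A(2) unfolding invertible_mat_def by blast
    then have C: "A * C = 1\<^sub>m n" "C * A = 1\<^sub>m (dim_row C)"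
      using A(1) by (auto simp: inverts_mat_def)
    have "dim_col C = n" "dim_row C = n"
      using arg_cong[OF C(1), of dim_col] arg_cong[OF C(2), of dim_col] A(1) by auto
    then show ?thesis
      using C by (intro bexI[of _ C]) auto
  qed
  obtain A' B' where *: "A' \<in> carrier_mat n n" "A * A' = 1\<^sub>m n" "A' * A = 1\<^sub>m n"
    "B' \<in> carrier_mat m m" "B * B' = 1\<^sub>m m" "B' * B = 1\<^sub>m m"
    using inv[OF assms(1,3)] inv[OF assms(2,4)] by blast
  have one: "block_diag (1\<^sub>m n) (1\<^sub>m m) = (1\<^sub>m (n + m) :: complex mat)"
    by (simp add: block_diag_def)
  have "block_diag A B * block_diag A' B' = 1\<^sub>m (n + m)" "block_diag A' B' * block_diag A B = 1\<^sub>m (n + m)"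
    using assms * one by (simp_all add: block_diag_mult[of _ n _ m])
  then show ?thesis
    using block_diag_carrier[OF assms(1,2)] block_diag_carrier[OF *(1,4)]
    unfolding invertible_mat_def inverts_mat_def by auto
qed

section \<open>Linear independence of Chebyshev polynomials\<close>

lemma chebyshev_U_lead: "degree (chebyshev_U k) \<le> k \<and> coeff (chebyshev_U k) k = 2 ^ k"
proof (induction k rule: chebyshev_U.induct)
  case (3 k)
  have "chebyshev_U (Suc (Suc k)) = pCons 0 (Polynomial.smult 2 (chebyshev_U (Suc k))) - chebyshev_U k"
    by simp
  moreover have "degree (pCons 0 (Polynomial.smult 2 (chebyshev_U (Suc k)))) \<le> Suc (Suc k)"
    using 3 by (intro order_trans[OF degree_pCons_le]) simp
  moreover have "degree (chebyshev_U k) \<le> Suc (Suc k)" "coeff (chebyshev_U k) (Suc (Suc k)) = 0"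
    using 3 by (auto intro: coeff_eq_0)
  ultimately show ?case
    using 3 by (simp add: degree_diff_le del: chebyshev_U.simps)
qed simp_all

text \<open>
  \<open>U\<^sub>k\<close> has degree exactly \<open>k\<close>, so the top coefficient of the combination isolates \<open>c\<^sub>K\<close>.
\<close>

lemma chebyshev_U_independent_real:
  fixes c :: "nat \<Rightarrow> real"
  assumes "(\<Sum>k\<le>K. Polynomial.smult (c k) (chebyshev_U k)) = 0" "k \<le> K"
  shows "c k = 0"
  using assms
proof (induction K)
  case 0
  then show ?case by simp
next
  case (Suc K)
  have "coeff (Polynomial.smult (c k) (chebyshev_U k)) (Suc K) = 0" if "k \<le> K" for k
  proof -
    have "degree (chebyshev_U k) < Suc K"
      using chebyshev_U_lead[of k] that by linarith
    then show ?thesis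
      by (simp add: coeff_eq_0)
  qed
  then have "coeff (\<Sum>k\<le>K. Polynomial.smult (c k) (chebyshev_U k)) (Suc K) = 0"
    unfolding coeff_sum by (intro sum.neutral) auto
  then have "coeff (\<Sum>k\<le>Suc K. Polynomial.smult (c k) (chebyshev_U k)) (Suc K) = c (Suc K) * 2 ^ Suc K"
    using chebyshev_U_lead[of "Suc K"] by (simp del: power_Suc)
  then have "c (Suc K) = 0"
    using Suc.prems(1) by (simp del: sum.atMost_Suc)
  then show ?case
    using Suc by (cases "k = Suc K") auto
qed

text \<open>
  A combination that vanishes on \<open>(-1, 1)\<close> is a polynomial with infinitely many zeros; real and
  imaginary parts are treated separately. This replaces the orthogonality relations of the \<open>U\<^sub>k\<close> for
  reading off coefficients.
\<close>

lemma chebyshev_U_independent: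
  fixes c :: "nat \<Rightarrow> complex"
  assumes "\<And>x. x \<in> {-1<..<1} \<Longrightarrow> (\<Sum>k\<le>K. c k * complex_of_real (poly (chebyshev_U k) x)) = 0"
    and "k \<le> K"
  shows "c k = 0"
proof -
  have zero: "p = 0" if "\<And>x. x \<in> {-1<..<1} \<Longrightarrow> poly p x = 0" for p :: "real poly"
  proof (rule ccontr)
    assume "p \<noteq> 0"
    then have "finite {x. poly p x = 0}"
      by (rule poly_roots_finite)
    then have "finite {-1<..<1::real}"
      by (rule finite_subset[rotated]) (use that in auto)
    then show False
      using infinite_Ioo[of "-1" "1::real"] by simp
  qed
  have "(\<Sum>k\<le>K. Polynomial.smult (Re (c k)) (chebyshev_U k)) = 0"
    using assms(1)[THEN arg_cong[where f = Re]] by (intro zero) (simp add: poly_sum Re_sum)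
  then have "Re (c k) = 0"
    using assms(2) by (rule chebyshev_U_independent_real)
  moreover have "(\<Sum>k\<le>K. Polynomial.smult (Im (c k)) (chebyshev_U k)) = 0"
    using assms(1)[THEN arg_cong[where f = Im]] by (intro zero) (simp add: poly_sum Im_sum)
  then have "Im (c k) = 0"
    using assms(2) by (rule chebyshev_U_independent_real)
  ultimately show ?thesis
    by (simp add: complex_eq_iff)
qed

section \<open>Irreducibility from coefficient matrices\<close>

text \<open>
  If \<open>\<W> = M diag(\<W>\<^sub>1, \<W>\<^sub>2) M\<^sup>*\<close>, let \<open>D\<close> be the projection on the first block. It is selfadjoint and
  commutes with \<open>diag(\<W>\<^sub>1, \<W>\<^sub>2)\<close>, so \<open>T = M D M\<^sup>-\<^sup>1\<close> satisfies \<open>T \<W> = \<W> T\<^sup>*\<close>. Since \<open>M\<close> need not be unitary,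
  \<open>T\<close> need not commute with \<open>\<W>\<close>, and the twisted relation is what is left of the commutant.
\<close>

lemma reduces_imp_intertwiner:
  assumes "reduces n \<W>"
  obtains T where "T \<in> carrier_mat n n" "\<And>c. T \<noteq> c \<cdot>\<^sub>m 1\<^sub>m n"
    "\<And>x. x \<in> {-1<..<1} \<Longrightarrow> T * \<W> x = \<W> x * mat_adjoint T"
proof -
  obtain n1 n2 M A B where n: "0 < n1" "0 < n2" "n1 + n2 = n"
    and M: "M \<in> carrier_mat n n" "invertible_mat M"
    and AB: "weight_matrix n1 A" "weight_matrix n2 B"
    and eq: "\<And>x. x \<in> {-1<..<1} \<Longrightarrow> \<W> x = M * block_diag (A x) (B x) * mat_adjoint M"
    using assms unfolding reduces_def by blast
  from M obtain L where "M * L = 1\<^sub>m (dim_row M)" "L * M = 1\<^sub>m (dim_row L)"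
    unfolding invertible_mat_def inverts_mat_def by blast
  then have LM: "M * L = 1\<^sub>m n" "L * M = 1\<^sub>m (dim_row L)"
    using M(1) by auto
  have "dim_col L = n" "dim_row L = n"
    using arg_cong[OF LM(1), of dim_col] arg_cong[OF LM(2), of dim_col] M(1) by simp_all
  with LM have L: "M * L = 1\<^sub>m n" "L * M = 1\<^sub>m n" "L \<in> carrier_mat n n"
    by auto
  define D :: "complex mat" where "D = block_diag (1\<^sub>m n1) (0\<^sub>m n2 n2)"
  have D: "D \<in> carrier_mat n n"
    using block_diag_carrier[of "1\<^sub>m n1" n1 "0\<^sub>m n2 n2" n2] n by (simp add: D_def)
  have "mat_adjoint (0\<^sub>m n2 n2) = (0\<^sub>m n2 n2 :: complex mat)"
    by (intro eq_matI) (auto simp: mat_adjoint_index mat_adjoint_dim)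
  then have Dadj: "mat_adjoint D = D"
    by (simp add: D_def mat_adjoint_block_diag[of _ n1 _ n2] mat_adjoint_one)
  let ?T = "M * D * L"
  note carr = M(1) L(3) D mat_adjoint_carrier[OF M(1)] mat_adjoint_carrier[OF L(3)]
  have T: "?T \<in> carrier_mat n n"
    using carr by simp
  have Tadj: "mat_adjoint ?T = mat_adjoint L * (D * mat_adjoint M)"
    using carr by (simp add: mat_adjoint_mult[of _ n n _ n] Dadj)
  have adj_LM: "mat_adjoint M * mat_adjoint L = 1\<^sub>m n"
    using carr L(2) mat_adjoint_mult[of L n n M n] by (simp add: mat_adjoint_one)
  show thesis
  proof
    show "?T \<in> carrier_mat n n"
      by (rule T)
    show "?T \<noteq> c \<cdot>\<^sub>m 1\<^sub>m n" for c
    proof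
      assume *: "?T = c \<cdot>\<^sub>m 1\<^sub>m n"
      have "D = (L * M) * D * (L * M)"
        using carr L(2) by simp
      also have "\<dots> = L * ?T * M"
        using carr by (simp add: assoc_mult_mat[of _ n n _ n _ n])
      also have "\<dots> = c \<cdot>\<^sub>m 1\<^sub>m n"
        unfolding * using carr L(2) by (simp add: mult_smult_distrib[of _ n n _ n] mult_smult_assoc_mat[of _ n n _ n])
      \<comment> \<open>The projection has both \<open>1\<close> and \<open>0\<close> on its diagonal, as both block sizes are positive.\<close>
      finally have "D $$ (0, 0) = c \<and> D $$ (n - 1, n - 1) = c"
        using n by simp
      moreover have "D $$ (0, 0) = 1" "D $$ (n - 1, n - 1) = 0"
        using n by (auto simp: D_def block_diag_def)
      ultimately show False
        by simp
    qed
    show "?T * \<W> x = \<W> x * mat_adjoint ?T" if x: "x \<in> {-1<..<1}" for x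
    proof -
      have carAB: "A x \<in> carrier_mat n1 n1" "B x \<in> carrier_mat n2 n2"
        using AB x by (auto simp: weight_matrix_def)
      define E where "E = block_diag (A x) (B x)"
      have E: "E \<in> carrier_mat n n"
        using block_diag_carrier[OF carAB] n by (simp add: E_def)
      have DE: "D * E = E * D"
        using carAB by (simp add: D_def E_def block_diag_mult[of _ n1 _ n2])
      have W: "\<W> x = M * (E * mat_adjoint M)"
        using eq[OF x] carr E by (simp add: E_def assoc_mult_mat[of _ n n _ n _ n])
      have "?T * \<W> x = M * (D * ((L * M) * (E * mat_adjoint M)))"
        unfolding W using carr E by (simp add: assoc_mult_mat[of _ n n _ n _ n])
      also have "\<dots> = M * ((D * E) * mat_adjoint M)"
        unfolding L(2) using carr E by (simp add: assoc_mult_mat[of _ n n _ n _ n])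
      also have "\<dots> = M * (E * ((mat_adjoint M * mat_adjoint L) * (D * mat_adjoint M)))"
        unfolding DE adj_LM using carr E by (simp add: assoc_mult_mat[of _ n n _ n _ n])
      also have "\<dots> = \<W> x * mat_adjoint ?T"
        unfolding W Tadj using carr E by (simp add: assoc_mult_mat[of _ n n _ n _ n])
      finally show ?thesis .
    qed
  qed
qed

text \<open>
  A criterion for irreducibility in terms of three coefficient matrices. If \<open>T \<W> = \<W> T\<^sup>*\<close> on \<open>(-1, 1)\<close>,
  then \<open>T F\<^sub>k = F\<^sub>k T\<^sup>*\<close> for each coefficient matrix \<open>F\<^sub>k\<close>, by independence of the \<open>U\<^sub>k\<close>. For two
  diagonal matrices \<open>F\<^sub>p\<close> and \<open>F\<^sub>q\<close> with entries \<open>d\<^sub>i \<noteq> 0\<close> and \<open>e\<^sub>i\<close> this gives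
   \<open>T\<^sub>i\<^sub>j d\<^sub>j = d\<^sub>i cnj T\<^sub>j\<^sub>i\<close> and \<open>T\<^sub>i\<^sub>j e\<^sub>j = e\<^sub>i cnj T\<^sub>j\<^sub>i\<close>; where
  \<open>T\<^sub>i\<^sub>j \<noteq> 0\<close> the quotients \<open>e\<^sub>i / d\<^sub>i\<close> and \<open>e\<^sub>j / d\<^sub>j\<close> agree, which forces \<open>i = j\<close>. So \<open>T\<close> is diagonal, and real.
  The nonzero entries of \<open>F\<^sub>r\<close> next to the diagonal equate consecutive diagonal entries of \<open>T\<close>. Hence
  \<open>T\<close> is scalar, which an intertwiner obtained from a reduction is not.
\<close>

lemma not_reduces_if_chebyshev_coefficients:
  fixes F :: "nat \<Rightarrow> nat \<Rightarrow> nat \<Rightarrow> real"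
  assumes carr: "\<And>x. x \<in> {-1<..<1} \<Longrightarrow> \<W> x \<in> carrier_mat n n"
    and expand: "\<And>x i j. x \<in> {-1<..<1} \<Longrightarrow> i < n \<Longrightarrow> j < n \<Longrightarrow>
      \<W> x $$ (i, j) = complex_of_real (sqrt (1 - x\<^sup>2) * (\<Sum>k\<le>K. F k i j * poly (chebyshev_U k) x))"
    and le: "p \<le> K" "q \<le> K"
    and diag: "\<And>i j. i < n \<Longrightarrow> j < n \<Longrightarrow> i \<noteq> j \<Longrightarrow> F p i j = 0 \<and> F q i j = 0"
    and nonzero: "\<And>i. i < n \<Longrightarrow> F p i i \<noteq> 0"
    and ratio: "\<And>i j. i < j \<Longrightarrow> j < n \<Longrightarrow> F p i i * F q j j \<noteq> F p j j * F q i i"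
    and linked: "\<And>i. Suc i < n \<Longrightarrow> r \<le> K \<and> F r i (Suc i) \<noteq> 0"
  shows "\<not> reduces n \<W>"
proof
  assume "reduces n \<W>"
  then obtain T where T: "T \<in> carrier_mat n n" "\<And>c. T \<noteq> c \<cdot>\<^sub>m 1\<^sub>m n"
    and TW: "\<And>x. x \<in> {-1<..<1} \<Longrightarrow> T * \<W> x = \<W> x * mat_adjoint T"
    using reduces_imp_intertwiner by blast
  have coeff: "(\<Sum>j<n. T $$ (i, j) * F k j m) = (\<Sum>j<n. F k i j * cnj (T $$ (m, j)))"
    if "i < n" "m < n" "k \<le> K" for i m k
  proof -
    let ?c = "\<lambda>k. (\<Sum>j<n. T $$ (i, j) * F k j m) - (\<Sum>j<n. F k i j * cnj (T $$ (m, j)))"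
    have "?c k = 0"
    proof (rule chebyshev_U_independent[where c = ?c, OF _ \<open>k \<le> K\<close>])
      fix x :: real assume x: "x \<in> {-1<..<1}"
      define w where "w = complex_of_real (sqrt (1 - x\<^sup>2))"
      have "x\<^sup>2 < 1"
        using x by (simp add: power2_less_1_iff abs_square_less_1 abs_less_iff)
      then have w: "w \<noteq> 0"
        by (simp add: w_def)
      let ?u = "\<lambda>k. complex_of_real (poly (chebyshev_U k) x)"
      have "(T * \<W> x) $$ (i, m) = w * (\<Sum>k\<le>K. (\<Sum>j<n. T $$ (i, j) * F k j m) * ?u k)"
      proof -
        have "(T * \<W> x) $$ (i, m) = (\<Sum>j<n. T $$ (i, j) * \<W> x $$ (j, m))"
          using that T(1) carr[OF x] by (simp add: scalar_prod_def atLeast0LessThan)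
        also have "\<dots> = (\<Sum>j<n. \<Sum>k\<le>K. w * (T $$ (i, j) * F k j m * ?u k))"
          using that by (intro sum.cong refl)
            (simp add: expand[OF x] w_def sum_distrib_left mult_ac)
        also have "\<dots> = w * (\<Sum>k\<le>K. (\<Sum>j<n. T $$ (i, j) * F k j m) * ?u k)"
          by (subst sum.swap) (simp add: sum_distrib_left sum_distrib_right)
        finally show ?thesis .
      qed
      moreover have "(\<W> x * mat_adjoint T) $$ (i, m) =
        w * (\<Sum>k\<le>K. (\<Sum>j<n. F k i j * cnj (T $$ (m, j))) * ?u k)"
      proof -
        have "(\<W> x * mat_adjoint T) $$ (i, m) = (\<Sum>j<n. \<W> x $$ (i, j) * cnj (T $$ (m, j)))"
          using that T(1) carr[OF x]
          by (simp add: scalar_prod_def atLeast0LessThan mat_adjoint_dim mat_adjoint_index)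
        also have "\<dots> = (\<Sum>j<n. \<Sum>k\<le>K. w * (F k i j * cnj (T $$ (m, j)) * ?u k))"
          using that by (intro sum.cong refl)
            (simp add: expand[OF x] w_def sum_distrib_left sum_distrib_right mult_ac)
        also have "\<dots> = w * (\<Sum>k\<le>K. (\<Sum>j<n. F k i j * cnj (T $$ (m, j))) * ?u k)"
          by (subst sum.swap) (simp add: sum_distrib_left sum_distrib_right)
        finally show ?thesis .
      qed
      ultimately have "(\<Sum>k\<le>K. (\<Sum>j<n. T $$ (i, j) * F k j m) * ?u k) =
          (\<Sum>k\<le>K. (\<Sum>j<n. F k i j * cnj (T $$ (m, j))) * ?u k)"
        using TW[OF x] w by simp
      then show "(\<Sum>k\<le>K. ?c k * ?u k) = 0"
        by (simp add: left_diff_distrib sum_subtractf)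
    qed
    then show ?thesis
      by simp
  qed
  have coeff_diag: "T $$ (i, j) * F k j j = F k i i * cnj (T $$ (j, i))"
    if ij: "i < n" "j < n" and k: "k = p \<or> k = q" for i j k
  proof -
    have "(\<Sum>m<n. T $$ (i, m) * F k m j) = (\<Sum>m<n. if m = j then T $$ (i, j) * F k j j else 0)"
      using ij k diag by (intro sum.cong) auto
    moreover have "(\<Sum>m<n. F k i m * cnj (T $$ (j, m))) =
      (\<Sum>m<n. if m = i then F k i i * cnj (T $$ (j, i)) else 0)"
      using ij k diag by (intro sum.cong) auto
    ultimately show ?thesis
      using coeff[OF ij, of k] ij k le by (elim disjE) simp_all
  qed
  have offdiag: "T $$ (i, j) = 0" if "i < n" "j < n" "i \<noteq> j" for i j
  proof (rule ccontr)
    assume nz: "T $$ (i, j) \<noteq> 0"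
    have "T $$ (i, j) * (F p j j * F q i i) = F p i i * F q i i * cnj (T $$ (j, i))"
      using coeff_diag[OF that(1,2), of p] by (simp add: mult.assoc[symmetric])
    also have "\<dots> = T $$ (i, j) * (F p i i * F q j j)"
      using coeff_diag[OF that(1,2), of q] by (simp add: mult_ac)
    finally have "complex_of_real (F p j j * F q i i) = complex_of_real (F p i i * F q j j)"
      using nz by simp
    then have "F p j j * F q i i = F p i i * F q j j"
      using of_real_eq_iff by blast
    then show False
      using ratio[of i j] ratio[of j i] that by (cases i j rule: linorder_cases) auto
  qed
  have real: "cnj (T $$ (i, i)) = T $$ (i, i)" if "i < n" for i
    using coeff_diag[of i i p] nonzero that by simp
  have step: "T $$ (Suc i, Suc i) = T $$ (i, i)" if i: "Suc i < n" for i
  proof -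
    have "(\<Sum>m<n. T $$ (i, m) * F r m (Suc i)) =
      (\<Sum>m<n. if m = i then T $$ (i, i) * F r i (Suc i) else 0)"
      using i offdiag by (intro sum.cong) auto
    moreover have "(\<Sum>m<n. F r i m * cnj (T $$ (Suc i, m))) =
      (\<Sum>m<n. if m = Suc i then F r i (Suc i) * T $$ (Suc i, Suc i) else 0)"
      using i offdiag real by (intro sum.cong) auto
    ultimately show ?thesis
      using coeff[of i "Suc i" r] le i linked[OF i] by simp
  qed
  have const: "T $$ (i, i) = T $$ (0, 0)" if "i < n" for i
    using that by (induction i) (simp_all add: step)
  have "T = T $$ (0, 0) \<cdot>\<^sub>m 1\<^sub>m n"
  proof (rule eq_matI)
    fix i j assume "i < dim_row (T $$ (0, 0) \<cdot>\<^sub>m 1\<^sub>m n)" "j < dim_col (T $$ (0, 0) \<cdot>\<^sub>m 1\<^sub>m n)"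
    then show "T $$ (i, j) = (T $$ (0, 0) \<cdot>\<^sub>m 1\<^sub>m n) $$ (i, j)"
      using offdiag[of i j] const[of i] by (cases "i = j") simp_all
  qed (use T(1) in auto)
  then show False
    using T(2) by blast
qed

section \<open>Orthogonal polynomials for a block diagonal weight\<close>

text \<open>
  Coefficient extraction, evaluation, products and adjoints all act blockwise, so the integrals to be
  computed are those of the two blocks, and \<open>0\<close> off the blocks.
\<close>

lemma matrix_OP_block_diag:
  assumes W: "\<And>x. x \<in> {-1<..<1} \<Longrightarrow> W1 x \<in> carrier_mat n1 n1 \<and> W2 x \<in> carrier_mat n2 n2 \<and>
      \<W> x = block_diag (W1 x) (W2 x)"
    and P: "matrix_OP n1 W1 P1" "matrix_OP n2 W2 P2"
  shows "matrix_OP (n1 + n2) \<W> (\<lambda>d. block_diag (P1 d) (P2 d))"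
proof -
  have carr: "P1 d \<in> carrier_mat n1 n1" "P2 d \<in> carrier_mat n2 n2" for d
    using P by (auto simp: matrix_OP_def)
  have coeff: "coeff_mat (block_diag (P1 d) (P2 d)) k = block_diag (coeff_mat (P1 d) k) (coeff_mat (P2 d) k)"
    for d k
    using carr[of d] by (intro eq_matI) (auto simp: coeff_mat_def block_diag_def)
  have eval: "eval_mat (block_diag (P1 d) (P2 d)) x = block_diag (eval_mat (P1 d) x) (eval_mat (P2 d) x)"
    for d x
    using carr[of d] by (intro eq_matI) (auto simp: eval_mat_def block_diag_def)
  have coeff_carr: "coeff_mat (P1 d) k \<in> carrier_mat n1 n1" "coeff_mat (P2 d) k \<in> carrier_mat n2 n2" for d k
    using carr[of d] by (auto simp: coeff_mat_def)
  have eval_carr: "eval_mat (P1 d) x \<in> carrier_mat n1 n1" "eval_mat (P2 d) x \<in> carrier_mat n2 n2" for d x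
    using carr[of d] by (auto simp: eval_mat_def)
  note adj_carr = eval_carr[THEN mat_adjoint_carrier]
  have zero: "block_diag (0\<^sub>m n1 n1) (0\<^sub>m n2 n2) = (0\<^sub>m (n1 + n2) (n1 + n2) :: complex mat)"
    by (simp add: block_diag_def)
  have "has_bochner_integral (lebesgue_on {-1<..<1})
      (\<lambda>x. (eval_mat (block_diag (P1 d) (P2 d)) x * \<W> x *
        mat_adjoint (eval_mat (block_diag (P1 d') (P2 d')) x)) $$ (i, j)) 0"
    if d: "d \<noteq> d'" and ij: "i < n1 + n2" "j < n1 + n2" for d d' i j
  proof -
    let ?Q1 = "\<lambda>x. eval_mat (P1 d) x * W1 x * mat_adjoint (eval_mat (P1 d') x)"
    let ?Q2 = "\<lambda>x. eval_mat (P2 d) x * W2 x * mat_adjoint (eval_mat (P2 d') x)"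
    let ?f = "\<lambda>x. if i < n1 then if j < n1 then ?Q1 x $$ (i, j) else 0
      else if j < n1 then 0 else ?Q2 x $$ (i - n1, j - n1)"
    have "(eval_mat (block_diag (P1 d) (P2 d)) x * \<W> x *
        mat_adjoint (eval_mat (block_diag (P1 d') (P2 d')) x)) $$ (i, j) = ?f x"
      if "x \<in> {-1<..<1}" for x
    proof -
      have "eval_mat (block_diag (P1 d) (P2 d)) x * \<W> x *
          mat_adjoint (eval_mat (block_diag (P1 d') (P2 d')) x) = block_diag (?Q1 x) (?Q2 x)"
        using W[OF that] eval_carr[of d x] eval_carr[of d' x] adj_carr[of d' x]
        by (simp add: eval block_diag_mult[of _ n1 _ n2] mat_adjoint_block_diag[of _ n1 _ n2])
      moreover have Q: "?Q1 x \<in> carrier_mat n1 n1" "?Q2 x \<in> carrier_mat n2 n2"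
        using W[OF that] eval_carr[of d x] adj_carr[of d' x] by (meson mult_carrier_mat)+
      ultimately show ?thesis
        by (simp only: block_diag_index[OF Q ij])
    qed
    moreover have "has_bochner_integral (lebesgue_on {-1<..<1}) ?f 0"
    proof -
      have "has_bochner_integral (lebesgue_on {-1<..<1}) (\<lambda>x. ?Q1 x $$ (i, j)) 0" if "i < n1" "j < n1"
        using P(1) d that by (auto simp: matrix_OP_def)
      moreover have "has_bochner_integral (lebesgue_on {-1<..<1}) (\<lambda>x. ?Q2 x $$ (i - n1, j - n1)) 0"
        if "\<not> i < n1" "\<not> j < n1"
      proof -
        have "i - n1 < n2" "j - n1 < n2"
          using that ij by auto
        then show ?thesis
          using P(2) d by (auto simp: matrix_OP_def)
      qed
      ultimately show ?thesis
        by (cases "i < n1"; cases "j < n1")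
          (simp_all only: if_True if_False simp_thms has_bochner_integral_zero)
    qed
    ultimately show ?thesis
      by (subst has_bochner_integral_cong[where N = "lebesgue_on {-1<..<1}" and g = ?f and y = 0]) auto
  qed
  moreover have "coeff_mat (P1 d) k = 0\<^sub>m n1 n1" "coeff_mat (P2 d) k = 0\<^sub>m n2 n2" if "k > d" for d k
    using P that by (auto simp: matrix_OP_def)
  moreover have "invertible_mat (coeff_mat (P1 d) d)" "invertible_mat (coeff_mat (P2 d) d)" for d
    using P by (auto simp: matrix_OP_def)
  ultimately show ?thesis
    unfolding matrix_OP_def coeff
    using carr coeff_carr
    by (auto simp: zero intro!: block_diag_carrier invertible_block_diag[of _ n1 _ n2])
qed

section \<open>Block diagonalization of the weight\<close>

theorem theorem6p5:
  fixes l :: real and N n1 n2 :: nat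
  assumes "2 * l = real N"
    and "int n1 = \<lceil>l + 1/2\<rceil>"
    and "int n2 = \<lfloor>l + 1/2\<rfloor>"
  shows "\<exists>W1 W2 :: real \<Rightarrow> complex mat.
     (\<forall>x \<in> {-1<..<1}. W1 x \<in> carrier_mat n1 n1 \<and> W2 x \<in> carrier_mat n2 n2 \<and>
        Y_mat N * W_mat N x * transpose_mat (Y_mat N) = block_diag (W1 x) (W2 x)) \<and>
     (\<forall>P1 P2. monic_matrix_OP n1 W1 P1 \<and> monic_matrix_OP n2 W2 P2 \<longrightarrow>
        matrix_OP (N + 1) (\<lambda>x. Y_mat N * W_mat N x * transpose_mat (Y_mat N))
          (\<lambda>d. block_diag (P1 d) (P2 d))) \<and>
     \<not> reduces n1 W1 \<and> \<not> reduces n2 W2"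
proof -
  \<comment> \<open>The first block consists of the rows with sign \<open>1\<close>, for either parity of \<open>N\<close>.\<close>
  have n: "n1 + n2 = N + 1" "i < n1 \<longleftrightarrow> 2 * i \<le> N" for i
  proof -
    have "int n1 = int (N div 2 + 1)"
      unfolding assms(2) using assms(1) by (intro ceiling_unique) (cases "even N"; auto elim!: evenE oddE)+
    moreover have "int n2 = int (N - N div 2)"
      unfolding assms(3) using assms(1) by (intro floor_unique) (cases "even N"; auto elim!: evenE oddE)+
    ultimately have "n1 = N div 2 + 1" "n2 = N - N div 2"
      by linarith+
    then show "n1 + n2 = N + 1" "i < n1 \<longleftrightarrow> 2 * i \<le> N"
      by auto
  qed
  have sign1: "Y_sign N i = 1" if "i < n1" for i
    using n(2)[of i] that by (simp add: Y_sign_def)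
  have sign2: "Y_sign N (n1 + i) = -1" for i
    using n(2)[of "n1 + i"] by (simp add: Y_sign_def)
  define V where "V x = Y_mat N * W_mat N x * transpose_mat (Y_mat N)" for x
  define W1 where "W1 x = mat n1 n1 (\<lambda>(i, j). V x $$ (i, j))" for x
  define W2 where "W2 x = mat n2 n2 (\<lambda>(i, j). V x $$ (n1 + i, n1 + j))" for x
  have V: "V x \<in> carrier_mat (n1 + n2) (n1 + n2)" for x
    using Y_mat_carrier[of N] W_mat_carrier[of N x] unfolding V_def n(1) by auto
  have V_index: "V x $$ (i, j) = complex_of_real
      (sqrt (1 - x\<^sup>2) * (\<Sum>k\<le>2 * N. folded_coeff N k i j * poly (chebyshev_U k) x))"
    if "i < n1 + n2" "j < n1 + n2" for x i j
    using that n(1) unfolding V_def by (intro Y_W_Y_index) auto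
  have V_block: "V x = block_diag (W1 x) (W2 x)" for x
  proof (rule eq_matI)
    fix i j assume "i < dim_row (block_diag (W1 x) (W2 x))" "j < dim_col (block_diag (W1 x) (W2 x))"
    then have ij: "i < n1 + n2" "j < n1 + n2"
      by (auto simp: block_diag_def W1_def W2_def)
    have "V x $$ (i, j) = 0" if "(i < n1) \<noteq> (j < n1)"
    proof -
      have "Y_sign N i \<noteq> Y_sign N j"
        using that n(2)[of i] n(2)[of j] by (auto simp: Y_sign_def)
      then show ?thesis
        using ij by (simp add: V_index folded_eq_0)
    qed
    then show "V x $$ (i, j) = block_diag (W1 x) (W2 x) $$ (i, j)"
      using ij by (auto simp: block_diag_def W1_def W2_def)
  qed (use V[of x] in \<open>auto simp: block_diag_def W1_def W2_def\<close>)
  have carr: "W1 x \<in> carrier_mat n1 n1" "W2 x \<in> carrier_mat n2 n2" for x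
    by (auto simp: W1_def W2_def)
  have "\<not> reduces n1 W1"
  proof (rule not_reduces_if_chebyshev_coefficients[where F = "folded_coeff N" and K = "2 * N" and p = 0 and q = N and r = 1])
    show "W1 x $$ (i, j) = complex_of_real
        (sqrt (1 - x\<^sup>2) * (\<Sum>k\<le>2 * N. folded_coeff N k i j * poly (chebyshev_U k) x))"
      if "i < n1" "j < n1" for x i j
      using that V_index by (simp add: W1_def)
    show "folded_coeff N 0 i j = 0 \<and> folded_coeff N N i j = 0" if "i < n1" "j < n1" "i \<noteq> j" for i j
      using that n by (intro folded_diagonal) auto
    show "folded_coeff N 0 i i \<noteq> 0" if "i < n1" for i
      using that n(2)[of i] by (simp add: folded_0_diag add_eq_0_iff)
    show "folded_coeff N 0 i i * folded_coeff N N j j \<noteq> folded_coeff N 0 j j * folded_coeff N N i i" if "i < j" "j < n1" for i j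
      using that n(2)[of j] sign1 by (intro folded_ratio) auto
    show "1 \<le> 2 * N \<and> folded_coeff N 1 i (Suc i) \<noteq> 0" if "Suc i < n1" for i
      using that n(2)[of "Suc i"] sign1 by (intro conjI folded_1_Suc) auto
  qed (auto simp: carr)
  moreover have "\<not> reduces n2 W2"
  proof (rule not_reduces_if_chebyshev_coefficients[where F = "\<lambda>k i j. folded_coeff N k (n1 + i) (n1 + j)"
        and K = "2 * N" and p = 0 and q = N and r = 1])
    show "W2 x $$ (i, j) = complex_of_real
        (sqrt (1 - x\<^sup>2) * (\<Sum>k\<le>2 * N. folded_coeff N k (n1 + i) (n1 + j) * poly (chebyshev_U k) x))"
      if "i < n2" "j < n2" for x i j
      using that V_index by (simp add: W2_def)
    show "folded_coeff N 0 (n1 + i) (n1 + j) = 0 \<and> folded_coeff N N (n1 + i) (n1 + j) = 0"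
      if "i < n2" "j < n2" "i \<noteq> j" for i j
      using that n(1) by (intro folded_diagonal) auto
    show "folded_coeff N 0 (n1 + i) (n1 + i) \<noteq> 0" if "i < n2" for i
      using that n(1) by (simp add: folded_0_diag add_eq_0_iff)
    show "folded_coeff N 0 (n1 + i) (n1 + i) * folded_coeff N N (n1 + j) (n1 + j) \<noteq>
        folded_coeff N 0 (n1 + j) (n1 + j) * folded_coeff N N (n1 + i) (n1 + i)" if "i < j" "j < n2" for i j
      using that n(1) sign2 by (intro folded_ratio) auto
    show "1 \<le> 2 * N \<and> folded_coeff N 1 (n1 + i) (n1 + Suc i) \<noteq> 0" if "Suc i < n2" for i
      using that n(1) sign2[of i] sign2[of "Suc i"] folded_1_Suc[of "n1 + i" N] by auto
  qed (auto simp: carr)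
  moreover have "matrix_OP (N + 1) V (\<lambda>d. block_diag (P1 d) (P2 d))"
    if "monic_matrix_OP n1 W1 P1" "monic_matrix_OP n2 W2 P2" for P1 P2
    using matrix_OP_block_diag[of W1 n1 W2 n2 V P1 P2] that carr V_block n(1)
    by (simp add: monic_matrix_OP_def)
  ultimately show ?thesis
    using carr V_block unfolding V_def by blast
qed

end
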